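(* Let $R$ be an integral domain, $\mathfrak G$ the matroid of a hyperplane arrangement on $[n]$, and $E$ a field extension of $R$ with $|E|>\binom n2+|\mathcal X_0(\mathfrak G)|$. Then every $\lambda\in R^n$ has a generic partner in $E^n$. If $R$ is infinite, every $\lambda\in R^n$ has a generic partner in $R^n$.
   Context: Let $\mathcal A=\{H_1,\dots,H_n\}$ be an arrangement of distinct linear hyperplanes in $\mathbb C^\ell$ and $\mathfrak G$ its matroid on $[n]$: circuits are the minimal $C\subseteq[n]$ with $\operatorname{codim}\bigcap_{i\in C}H_i<|C|$. A line of $\mathfrak G$ is a set $X=\{k: H_k\supseteq H_i\cap H_j\}$ for some $i\ne j$; $\mathcal X_0(\mathfrak G)$ is the set of lines with $|X|\ge3$. For a commutative ring $S$, $A_S(\mathfrak G)$ is the quotient of the exterior algebra over $S$ on $e_1,\dots,e_n$ by the ideal generated by $\partial e_C=\sum_{k=1}^p(-1)^{k-1}e_{i_1}\wedge\cdots\widehat{e_{i_k}}\cdots\wedge e_{i_p}$ for circuits $C=\{i_1<\dots<i_p\}$; $a_i$ is the image of $e_i$, $a_\xi=\sum_i\xi_ia_i$, and $Z(\lambda,S)=\{\eta\in S^n:a_\lambda\wedge a_\eta=0\}$. For $\xi$ and $X\subseteq[n]$, $\xi_X=\sum_{i\in X}\xi_i$. For $\lambda\in R^n$ and a field $E\supseteq R$, $\mu\in E^n$ is a generic partner of $\lambda$ if $\mu\in Z(\lambda,E)$ and: (i) if $X\in\mathcal X_0(\mathfrak G)$ and $\mu_X=0$, then $\eta_X=0$ for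 all $\eta\in Z(\lambda,R)$; and (ii) if $1\le i<j\le n$ and $\lambda_i\mu_j-\lambda_j\mu_i=0$, then $\lambda_i\eta_j-\lambda_j\eta_i=0$ for every $\eta\in Z(\lambda,R)$. *)

theory Defs
  imports "HOL-Analysis.Analysis" "HOL-Algebra.QuotRing"
begin

section \<open>Arrangements of linear hyperplanes and their matroids\<close>

(* vec.subspace and vec.dim are the notions over the scalar field, here the complex numbers
   (the unqualified subspace and dim would be the real ones). *)

definition codim :: "(complex ^ 'l) set \<Rightarrow> nat" where
  "codim V = CARD('l) - vec.dim V"

definition linear_hyperplane :: "(complex ^ 'l) set \<Rightarrow> bool" where
  "linear_hyperplane V \<longleftrightarrow> vec.subspace V \<and> vec.dim V + 1 = CARD('l)"

(* The arrangement is the family H 1, ..., H n; other values of H are ignored throughout. *)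
definition arrangement :: "nat \<Rightarrow> (nat \<Rightarrow> (complex ^ 'l) set) \<Rightarrow> bool" where
  "arrangement n H \<longleftrightarrow> (\<forall>i\<in>{1..n}. linear_hyperplane (H i)) \<and> inj_on H {1..n}"

definition dependent_set :: "nat \<Rightarrow> (nat \<Rightarrow> (complex ^ 'l) set) \<Rightarrow> nat set \<Rightarrow> bool" where
  "dependent_set n H C \<longleftrightarrow> C \<subseteq> {1..n} \<and> codim (\<Inter>i\<in>C. H i) < card C"

definition circuit :: "nat \<Rightarrow> (nat \<Rightarrow> (complex ^ 'l) set) \<Rightarrow> nat set \<Rightarrow> bool" where
  "circuit n H C \<longleftrightarrow> dependent_set n H C \<and> (\<forall>D. D \<subset> C \<longrightarrow> \<not> dependent_set n H D)"

definition matroid_lines :: "nat \<Rightarrow> (nat \<Rightarrow> (complex ^ 'l) set) \<Rightarrow> nat set set" where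
  "matroid_lines n H =
    {X. \<exists>i\<in>{1..n}. \<exists>j\<in>{1..n}. i \<noteq> j \<and> X = {k\<in>{1..n}. H i \<inter> H j \<subseteq> H k}}"

definition lines0 :: "nat \<Rightarrow> (nat \<Rightarrow> (complex ^ 'l) set) \<Rightarrow> nat set set" where
  "lines0 n H = {X \<in> matroid_lines n H. card X \<ge> 3}"


section \<open>The exterior algebra on \<open>e\<^sub>1, \<dots>, e\<^sub>n\<close>\<close>

(* The free module on the monomials e_U = e_{u_1} ^ ... ^ e_{u_p}, U = {u_1 < ... < u_p} a subset
   of {1..n}; an element is the function sending U to the coefficient of e_U. For disjoint S, T,
   e_S ^ e_T = wedge_sign S T * e_{S Un T}, and e_S ^ e_T = 0 otherwise. *)

definition wedge_sign :: "nat set \<Rightarrow> nat set \<Rightarrow> 's::comm_ring_1" where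
  "wedge_sign S T = (- 1) ^ card {(s, t). s \<in> S \<and> t \<in> T \<and> t < s}"

definition ext_monomial :: "nat set \<Rightarrow> nat set \<Rightarrow> 's::comm_ring_1" where
  "ext_monomial S = (\<lambda>U. if U = S then 1 else 0)"

definition ext_algebra :: "nat \<Rightarrow> (nat set \<Rightarrow> 's::comm_ring_1) ring" where
  "ext_algebra n =
    \<lparr> carrier = {x. \<forall>U. \<not> U \<subseteq> {1..n} \<longrightarrow> x U = 0},
      monoid.mult = (\<lambda>x y U. \<Sum>S\<in>Pow U. wedge_sign S (U - S) * x S * y (U - S)),
      one = ext_monomial {},
      ring.zero = (\<lambda>U. 0),
      add = (\<lambda>x y U. x U + y U) \<rparr>"

(* In the i-th term of the boundary of C the sign is (-1)^(k-1), where i is the k-th smallest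
   element of C. *)
definition ext_boundary :: "nat set \<Rightarrow> nat set \<Rightarrow> 's::comm_ring_1" where
  "ext_boundary C = (\<lambda>U. \<Sum>i\<in>C. (- 1) ^ card {j\<in>C. j < i} * ext_monomial (C - {i}) U)"

(* e_xi = sum of xi_i e_i *)
definition ext_linear :: "nat \<Rightarrow> (nat \<Rightarrow> 's::comm_ring_1) \<Rightarrow> nat set \<Rightarrow> 's" where
  "ext_linear n \<xi> = (\<lambda>U. \<Sum>i\<in>{1..n}. \<xi> i * ext_monomial {i} U)"


subsection \<open>It is a ring, so that \<open>Idl\<close> and \<open>Quot\<close> have their intended meaning\<close>

lemma wedge_sign_empty [simp]: "wedge_sign {} T = 1" "wedge_sign S {} = 1"
  by (simp_all add: wedge_sign_def)

lemma wedge_sign_Un_left: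
  assumes "finite S" "finite T" "finite W" "S \<inter> T = {}"
  shows "wedge_sign (S \<union> T) W = (wedge_sign S W * wedge_sign T W :: 's::comm_ring_1)"
proof -
  have fin: "finite {(s, t). s \<in> A \<and> t \<in> B \<and> t < s}" if "finite A" "finite B" for A B :: "nat set"
    by (rule finite_subset[of _ "A \<times> B"]) (use that in auto)
  have eq: "{(s, t). s \<in> S \<union> T \<and> t \<in> W \<and> t < s} =
      {(s, t). s \<in> S \<and> t \<in> W \<and> t < s} \<union> {(s, t). s \<in> T \<and> t \<in> W \<and> t < s}" by auto
  show ?thesis unfolding wedge_sign_def eq
    by (subst card_Un_disjoint) (use assms fin in \<open>auto simp: power_add\<close>)
qed

lemma wedge_sign_Un_right:
  assumes "finite S" "finite T" "finite W" "T \<inter> W = {}"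
  shows "wedge_sign S (T \<union> W) = (wedge_sign S T * wedge_sign S W :: 's::comm_ring_1)"
proof -
  have fin: "finite {(s, t). s \<in> A \<and> t \<in> B \<and> t < s}" if "finite A" "finite B" for A B :: "nat set"
    by (rule finite_subset[of _ "A \<times> B"]) (use that in auto)
  have eq: "{(s, t). s \<in> S \<and> t \<in> T \<union> W \<and> t < s} =
      {(s, t). s \<in> S \<and> t \<in> T \<and> t < s} \<union> {(s, t). s \<in> S \<and> t \<in> W \<and> t < s}" by auto
  show ?thesis unfolding wedge_sign_def eq
    by (subst card_Un_disjoint) (use assms fin in \<open>auto simp: power_add\<close>)
qed

lemma ext_mult_assoc:
  fixes x y z :: "nat set \<Rightarrow> 's::comm_ring_1"
  assumes U: "finite U"
  shows "(\<Sum>V\<in>Pow U. wedge_sign V (U - V) *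
            (\<Sum>S\<in>Pow V. wedge_sign S (V - S) * x S * y (V - S)) * z (U - V)) =
         (\<Sum>S\<in>Pow U. wedge_sign S (U - S) * x S *
            (\<Sum>T\<in>Pow (U - S). wedge_sign T (U - S - T) * y T * z (U - S - T)))"
    (is "?L = ?R")
proof -
  have fin: "finite V" if "V \<subseteq> U" for V using that U finite_subset by blast
  have "?L = (\<Sum>(V, S)\<in>Sigma (Pow U) Pow. wedge_sign V (U - V) *
            (wedge_sign S (V - S) * x S * y (V - S)) * z (U - V))"
    by (subst sum.Sigma[symmetric]) (auto simp: U fin sum_distrib_left sum_distrib_right)
  also have "\<dots> = (\<Sum>(S, T)\<in>Sigma (Pow U) (\<lambda>S. Pow (U - S)). wedge_sign S (U - S) * x S *
            (wedge_sign T (U - S - T) * y T * z (U - S - T)))"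
  proof (rule sum.reindex_bij_witness[where i = "\<lambda>(S, T). (S \<union> T, S)" and j = "\<lambda>(V, S). (S, V - S)"],
      goal_cases)
    case (5 p)
    then obtain V S where p: "p = (V, S)" "V \<subseteq> U" "S \<subseteq> V" by auto
    define T W where "T = V - S" and "W = U - V"
    have V: "V = S \<union> T" and e: "U - S = T \<union> W" "U - S - T = W"
      using p by (auto simp: T_def W_def)
    have f: "finite S" "finite T" "finite W" "S \<inter> T = {}" "T \<inter> W = {}"
      using p fin[of V] U finite_subset[of S V] by (auto simp: T_def W_def)
    have sgn: "wedge_sign S (U - S) * wedge_sign T W = (wedge_sign V W * wedge_sign S T :: 's)"
      unfolding e(1) V wedge_sign_Un_left[OF f(1-4)] wedge_sign_Un_right[OF f(1-3,5)]
      by (simp only: mult_ac)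
    have "wedge_sign S (U - S) * x S * (wedge_sign T W * y T * z W) =
        (wedge_sign S (U - S) * wedge_sign T W) * (x S * y T * z W)"
      by (simp only: mult_ac)
    also have "\<dots> = wedge_sign V W * (wedge_sign S T * x S * y T) * z W"
      unfolding sgn by (simp only: mult_ac)
    finally show ?case
      unfolding p(1) split T_def[symmetric] W_def[symmetric] e(2) .
  qed auto
  also have "\<dots> = ?R"
    by (subst sum.Sigma[symmetric]) (auto simp: U sum_distrib_left)
  finally show ?thesis .
qed

lemma ring_ext_algebra: "ring (ext_algebra n :: (nat set \<Rightarrow> 's::comm_ring_1) ring)"
proof (rule ringI)
  let ?E = "ext_algebra n :: (nat set \<Rightarrow> 's) ring"
  show "abelian_group ?E"
  proof (rule abelian_groupI)
    show "\<exists>y\<in>carrier ?E. y \<oplus>\<^bsub>?E\<^esub> x = \<zero>\<^bsub>?E\<^esub>" if "x \<in> carrier ?E" for x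
      using that by (intro bexI[of _ "\<lambda>U. - x U"]) (auto simp: ext_algebra_def)
  qed (auto simp: ext_algebra_def add_ac)
  show "Group.monoid ?E"
  proof (rule monoidI)
    fix x y assume x: "x \<in> carrier ?E" and y: "y \<in> carrier ?E"
    have *: "x S * y (U - S) = 0" if "\<not> U \<subseteq> {1..n}" "S \<subseteq> U" for U S
    proof (cases "S \<subseteq> {1..n}")
      case True
      with that have "\<not> U - S \<subseteq> {1..n}" by blast
      then show ?thesis using y by (auto simp: ext_algebra_def)
    next
      case False
      then show ?thesis using x by (auto simp: ext_algebra_def)
    qed
    show "x \<otimes>\<^bsub>?E\<^esub> y \<in> carrier ?E"
      by (auto simp: ext_algebra_def mult.assoc * intro!: sum.neutral)
  next
    show "\<one>\<^bsub>?E\<^esub> \<in> carrier ?E" by (auto simp: ext_algebra_def ext_monomial_def)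
  next
    fix x y z assume "x \<in> carrier ?E" "y \<in> carrier ?E" "z \<in> carrier ?E"
    show "(x \<otimes>\<^bsub>?E\<^esub> y) \<otimes>\<^bsub>?E\<^esub> z = x \<otimes>\<^bsub>?E\<^esub> (y \<otimes>\<^bsub>?E\<^esub> z)"
    proof
      fix U
      show "((x \<otimes>\<^bsub>?E\<^esub> y) \<otimes>\<^bsub>?E\<^esub> z) U = (x \<otimes>\<^bsub>?E\<^esub> (y \<otimes>\<^bsub>?E\<^esub> z)) U"
      proof (cases "finite U")
        case True
        from ext_mult_assoc[OF this, of x y z] show ?thesis by (simp add: ext_algebra_def)
      next
        case False
        then show ?thesis by (simp add: ext_algebra_def)
      qed
    qed
  next
    fix x assume x: "x \<in> carrier ?E"
    have inf: "x U = 0" if "infinite U" for U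
      using x that finite_subset by (fastforce simp: ext_algebra_def)
    show "\<one>\<^bsub>?E\<^esub> \<otimes>\<^bsub>?E\<^esub> x = x"
    proof
      fix U
      show "(\<one>\<^bsub>?E\<^esub> \<otimes>\<^bsub>?E\<^esub> x) U = x U"
      proof (cases "finite U")
        case True
        have "(\<Sum>S\<in>Pow U. wedge_sign S (U - S) * ext_monomial {} S * x (U - S)) =
              (\<Sum>S\<in>Pow U. if S = {} then x U else 0)"
          by (intro sum.cong) (auto simp: ext_monomial_def)
        then show ?thesis using True by (simp add: ext_algebra_def sum.delta)
      qed (simp add: ext_algebra_def inf)
    qed
    show "x \<otimes>\<^bsub>?E\<^esub> \<one>\<^bsub>?E\<^esub> = x"
    proof
      fix U
      show "(x \<otimes>\<^bsub>?E\<^esub> \<one>\<^bsub>?E\<^esub>) U = x U"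
      proof (cases "finite U")
        case True
        have "(\<Sum>S\<in>Pow U. wedge_sign S (U - S) * x S * ext_monomial {} (U - S)) =
              (\<Sum>S\<in>Pow U. if S = U then x U else 0)"
          by (intro sum.cong) (auto simp: ext_monomial_def)
        then show ?thesis using True by (simp add: ext_algebra_def sum.delta)
      qed (simp add: ext_algebra_def inf)
    qed
  qed
qed (auto simp: ext_algebra_def algebra_simps sum.distrib)

lemma ext_monomial_in_carrier: "U \<subseteq> {1..n} \<Longrightarrow> ext_monomial U \<in> carrier (ext_algebra n)"
  by (auto simp: ext_algebra_def ext_monomial_def)

lemma ext_linear_in_carrier: "ext_linear n \<xi> \<in> carrier (ext_algebra n)"
  by (auto simp: ext_algebra_def ext_linear_def ext_monomial_def intro!: sum.neutral)

lemma ext_boundary_in_carrier: "C \<subseteq> {1..n} \<Longrightarrow> ext_boundary C \<in> carrier (ext_algebra n)"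
  by (auto simp: ext_algebra_def ext_boundary_def ext_monomial_def intro!: sum.neutral)


section \<open>The Orlik--Solomon algebra and generic partners\<close>

definition os_ideal ::
  "nat \<Rightarrow> (nat \<Rightarrow> (complex ^ 'l) set) \<Rightarrow> (nat set \<Rightarrow> 's::comm_ring_1) set" where
  "os_ideal n H = Idl\<^bsub>ext_algebra n\<^esub> {ext_boundary C | C. circuit n H C}"

definition os_algebra ::
  "nat \<Rightarrow> (nat \<Rightarrow> (complex ^ 'l) set) \<Rightarrow> (nat set \<Rightarrow> 's::comm_ring_1) set ring" where
  "os_algebra n H = ext_algebra n Quot os_ideal n H"

(* a_xi, as the residue class of e_xi *)
definition os_linear ::
  "nat \<Rightarrow> (nat \<Rightarrow> (complex ^ 'l) set) \<Rightarrow> (nat \<Rightarrow> 's::comm_ring_1) \<Rightarrow> (nat set \<Rightarrow> 's) set" where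
  "os_linear n H \<xi> = os_ideal n H +>\<^bsub>ext_algebra n\<^esub> ext_linear n \<xi>"

(* A vector of S^n is a function on nat of which only the values at 1, ..., n matter. *)
definition os_annihilator ::
  "nat \<Rightarrow> (nat \<Rightarrow> (complex ^ 'l) set) \<Rightarrow> (nat \<Rightarrow> 's::comm_ring_1) \<Rightarrow> (nat \<Rightarrow> 's) set" where
  "os_annihilator n H l =
    {\<eta>. os_linear n H l \<otimes>\<^bsub>os_algebra n H\<^esub> os_linear n H \<eta> = \<zero>\<^bsub>os_algebra n H\<^esub>}"

(* The inclusion of R into its extension field E is an explicit injective homomorphism. *)
definition ring_embedding :: "('r::comm_ring_1 \<Rightarrow> 'e::comm_ring_1) \<Rightarrow> bool" where
  "ring_embedding \<phi> \<longleftrightarrow>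
    \<phi> 1 = 1 \<and> (\<forall>x y. \<phi> (x + y) = \<phi> x + \<phi> y) \<and> (\<forall>x y. \<phi> (x * y) = \<phi> x * \<phi> y) \<and> inj \<phi>"

definition generic_partner ::
  "nat \<Rightarrow> (nat \<Rightarrow> (complex ^ 'l) set) \<Rightarrow> ('r::comm_ring_1 \<Rightarrow> 'e::field) \<Rightarrow>
    (nat \<Rightarrow> 'r) \<Rightarrow> (nat \<Rightarrow> 'e) \<Rightarrow> bool" where
  "generic_partner n H \<phi> l \<mu> \<longleftrightarrow>
    \<mu> \<in> os_annihilator n H (\<lambda>i. \<phi> (l i)) \<and>
    (\<forall>X\<in>lines0 n H. (\<Sum>i\<in>X. \<mu> i) = 0 \<longrightarrow>
      (\<forall>\<eta>\<in>os_annihilator n H l. (\<Sum>i\<in>X. \<eta> i) = 0)) \<and>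
    (\<forall>i j. 1 \<le> i \<and> i < j \<and> j \<le> n \<and> \<phi> (l i) * \<mu> j - \<phi> (l j) * \<mu> i = 0 \<longrightarrow>
      (\<forall>\<eta>\<in>os_annihilator n H l. l i * \<eta> j - l j * \<eta> i = 0))"

end

theory Submission
  imports Defs
begin

text \<open>Each of the conditions (i) and (ii) says that a linear functional \<open>f\<close> which does not vanish
identically on \<open>Z(\<lambda>, R)\<close> does not vanish at \<open>\<mu>\<close>. There are at most \<open>n choose 2\<close> plus the number
of lines in \<open>\<X>\<^sub>0\<close> such functionals. Since \<open>Z(\<lambda>, E)\<close> is a subspace of \<open>E\<^sup>n\<close> that contains the image of
\<open>Z(\<lambda>, R)\<close>, none of these functionals vanishes identically on \<open>Z(\<lambda>, E)\<close>, and a subspace is not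
covered by fewer than \<open>|E|\<close> proper subspaces. The same argument over an infinite domain \<open>R\<close>, applied
to the submodule \<open>Z(\<lambda>, R)\<close>, gives a generic partner with entries in \<open>R\<close>. The only property of the
Orlik--Solomon relations that enters is that they have coefficients \<open>\<plusminus>1\<close>, so that they are compatible
with the change of scalars from \<open>R\<close> to \<open>E\<close>.\<close>

section \<open>Avoiding the kernels of finitely many functionals\<close>

text \<open>Induction on \<open>F\<close>: if \<open>v\<close> avoids the kernels of all of
  \<open>F\<close> and \<open>g w \<noteq> 0\<close>, then on the line \<open>v + t * w\<close>
  every functional vanishes for at most one \<open>t\<close>, so some \<open>t\<close> is good for
  all of them. Closure under \<open>v + t * w\<close> makes the result apply to submodules over a
  domain as well as to subspaces. In HOL an infinite type has \<open>card\<close> 0, hence the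
  disjunction.\<close>

lemma common_nonzero_of_functionals:
  fixes V :: "('a \<Rightarrow> 'b::idom) set" and F :: "(('a \<Rightarrow> 'b) \<Rightarrow> 'b) set"
  assumes "finite F" "V \<noteq> {}"
    and "infinite (UNIV :: 'b set) \<or> card F < card (UNIV :: 'b set)"
    and closed: "\<And>v w t. v \<in> V \<Longrightarrow> w \<in> V \<Longrightarrow> (\<lambda>i. v i + t * w i) \<in> V"
    and "\<And>f v w t. f \<in> F \<Longrightarrow> f (\<lambda>i. v i + t * w i) = f v + t * f w"
    and "\<And>f. f \<in> F \<Longrightarrow> \<exists>v\<in>V. f v \<noteq> 0"
  shows "\<exists>v\<in>V. \<forall>f\<in>F. f v \<noteq> 0"
  using assms(1,3,5,6)
proof (induction F rule: finite_induct)
  case empty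
  then show ?case using \<open>V \<noteq> {}\<close> by blast
next
  case (insert g F)
  have "\<exists>v\<in>V. \<forall>f\<in>F. f v \<noteq> 0"
    using insert.hyps insert.prems by (intro insert.IH) auto
  then obtain v where v: "v \<in> V" "\<And>f. f \<in> F \<Longrightarrow> f v \<noteq> 0" by blast
  obtain w where w: "w \<in> V" "g w \<noteq> 0" using insert.prems(3) by blast
  define B where "B = {t. \<exists>f\<in>insert g F. f v + t * f w = 0}"
  \<comment> \<open>The parameter at which \<open>f\<close> vanishes on the line; its arbitrary
    value when there is none is harmless, since \<open>r\<close> only has to cover
    \<open>B\<close>.\<close>
  define r where "r f = (SOME t. f v + t * f w = 0)" for f :: "('a \<Rightarrow> 'b) \<Rightarrow> 'b"
  have "t = r f" if f: "f \<in> insert g F" and t: "f v + t * f w = 0" for t f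
  proof -
    have "f v + r f * f w = 0" unfolding r_def using t by (rule someI)
    with t have "t * f w = r f * f w" by (metis add_left_cancel)
    \<comment> \<open>If \<open>f w\<close> were 0, then \<open>f v\<close> would be 0 too,
      impossible for \<open>f\<close> in \<open>F\<close>; for \<open>f = g\<close> this is the
      choice of \<open>w\<close>.\<close>
    moreover have "f w \<noteq> 0" using f t v(2) w(2) by auto
    ultimately show ?thesis by simp
  qed
  then have sub: "B \<subseteq> r ` insert g F" unfolding B_def by blast
  have fin: "finite (insert g F)" using insert.hyps by simp
  have "finite B" by (rule finite_subset[OF sub finite_imageI[OF fin]])
  moreover have "card B \<le> card (insert g F)" by (rule surj_card_le[OF fin sub])
  ultimately have "B \<noteq> UNIV" using insert.prems(1) by auto
  then obtain t where "t \<notin> B" by blast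
  then have "\<forall>f\<in>insert g F. f (\<lambda>i. v i + t * w i) \<noteq> 0"
    unfolding B_def by (simp add: insert.prems(2))
  with closed[OF v(1) w(1)] show ?case by blast
qed

section \<open>Annihilators in the Orlik--Solomon algebra\<close>

lemma ext_boundaries_in_carrier:
  "{ext_boundary C | C. circuit n H C} \<subseteq> carrier (ext_algebra n)"
proof clarify
  fix C assume "circuit n H C"
  then have "C \<subseteq> {1..n}" by (simp add: circuit_def dependent_set_def)
  then show "ext_boundary C \<in> carrier (ext_algebra n)" by (rule ext_boundary_in_carrier)
qed

lemma ideal_os_ideal:
  "ideal (os_ideal n H :: (nat set \<Rightarrow> 's::comm_ring_1) set) (ext_algebra n)"
  unfolding os_ideal_def
  by (rule ring.genideal_ideal[OF ring_ext_algebra ext_boundaries_in_carrier])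

text \<open>Cosets multiply through representatives, and a coset is zero iff its representative lies
  in the ideal. From here on the quotient is replaced by ideal membership.\<close>

lemma mem_os_annihilator_iff:
  fixes l \<eta> :: "nat \<Rightarrow> 's::comm_ring_1"
  shows "\<eta> \<in> os_annihilator n H l \<longleftrightarrow>
    ext_linear n l \<otimes>\<^bsub>ext_algebra n\<^esub> ext_linear n \<eta> \<in> os_ideal n H"
proof -
  let ?E = "ext_algebra n :: (nat set \<Rightarrow> 's) ring"
  let ?I = "os_ideal n H :: (nat set \<Rightarrow> 's) set"
  interpret ideal ?I ?E by (rule ideal_os_ideal)
  let ?p = "ext_linear n l \<otimes>\<^bsub>?E\<^esub> ext_linear n \<eta>"
  have p: "?p \<in> carrier ?E" by (simp add: ext_linear_in_carrier)
  have "\<eta> \<in> os_annihilator n H l \<longleftrightarrow> ?I +>\<^bsub>?E\<^esub> ?p = ?I"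
    by (simp add: os_annihilator_def os_algebra_def os_linear_def FactRing_def
        rcoset_mult_add ext_linear_in_carrier)
  also have "\<dots> \<longleftrightarrow> ?p \<in> ?I"
    using p a_rcos_zero[OF ideal_os_ideal] abelian_subgroup.a_rcos_self
      abelian_subgroupI3[OF additive_subgroup_axioms is_abelian_group] by metis
  finally show ?thesis .
qed

text \<open>Scaling by \<open>t\<close> is multiplication by the ring element \<open>t\<close> times
  the unit monomial, and the ideal absorbs it.\<close>

lemma os_ideal_smult:
  fixes x :: "nat set \<Rightarrow> 's::comm_ring_1"
  assumes "x \<in> os_ideal n H"
  shows "(\<lambda>U. t * x U) \<in> os_ideal n H"
proof -
  let ?E = "ext_algebra n :: (nat set \<Rightarrow> 's) ring"
  interpret ideal "os_ideal n H" ?E by (rule ideal_os_ideal)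
  let ?c = "\<lambda>U. t * ext_monomial {} U"
  have "?c \<in> carrier ?E" by (auto simp: ext_algebra_def ext_monomial_def)
  \<comment> \<open>Keeping the unit factor on the right lets both sides unfold to the same sum over
    subsets; the unit law removes it at the end.\<close>
  moreover have "?c \<otimes>\<^bsub>?E\<^esub> x = (\<lambda>U. t * (\<one>\<^bsub>?E\<^esub> \<otimes>\<^bsub>?E\<^esub> x) U)"
    by (simp add: ext_algebra_def sum_distrib_left mult_ac)
  moreover have "x \<in> carrier ?E" using assms by (rule Icarr)
  ultimately show ?thesis using I_l_closed[OF assms, of ?c] by simp
qed

lemma os_annihilator_combination:
  assumes "v \<in> os_annihilator n H l" "w \<in> os_annihilator n H l"
  shows "(\<lambda>i. v i + t * w i) \<in> os_annihilator n H (l :: nat \<Rightarrow> 's::comm_ring_1)"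
proof -
  let ?E = "ext_algebra n :: (nat set \<Rightarrow> 's) ring"
  interpret ideal "os_ideal n H" ?E by (rule ideal_os_ideal)
  have "ext_linear n l \<otimes>\<^bsub>?E\<^esub> ext_linear n (\<lambda>i. v i + t * w i) =
      (ext_linear n l \<otimes>\<^bsub>?E\<^esub> ext_linear n v) \<oplus>\<^bsub>?E\<^esub>
      (\<lambda>U. t * (ext_linear n l \<otimes>\<^bsub>?E\<^esub> ext_linear n w) U)"
  proof -
    have "ext_linear n (\<lambda>i. v i + t * w i) = (\<lambda>U. ext_linear n v U + t * ext_linear n w U)"
      by (simp add: ext_linear_def sum_distrib_left sum.distrib algebra_simps)
    then show ?thesis
      by (simp add: ext_algebra_def sum_distrib_left sum.distrib algebra_simps)
  qed
  with assms show ?thesis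
    by (simp add: mem_os_annihilator_iff os_ideal_smult a_closed)
qed

lemma zero_in_os_annihilator: "(\<lambda>i. 0) \<in> os_annihilator n H (l :: nat \<Rightarrow> 's::comm_ring_1)"
proof -
  let ?E = "ext_algebra n :: (nat set \<Rightarrow> 's) ring"
  interpret ideal "os_ideal n H" ?E by (rule ideal_os_ideal)
  have "ext_linear n (\<lambda>i. 0 :: 's) = \<zero>\<^bsub>?E\<^esub>" by (simp add: ext_linear_def ext_algebra_def)
  then show ?thesis by (simp add: mem_os_annihilator_iff ext_linear_in_carrier)
qed

section \<open>Change of scalars\<close>

context
  fixes \<phi> :: "'r::comm_ring_1 \<Rightarrow> 'e::comm_ring_1"
  assumes emb: "ring_embedding \<phi>"
begin

lemma emb_one: "\<phi> 1 = 1" and emb_add: "\<phi> (x + y) = \<phi> x + \<phi> y"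
  and emb_mult: "\<phi> (x * y) = \<phi> x * \<phi> y"
  using emb by (auto simp: ring_embedding_def)

lemma emb_zero: "\<phi> 0 = 0"
  using emb_add[of 0 0] by simp

lemma emb_eq_0_iff: "\<phi> x = 0 \<longleftrightarrow> x = 0"
  using emb emb_zero unfolding ring_embedding_def by (metis injD)

lemma emb_diff: "\<phi> (x - y) = \<phi> x - \<phi> y"
  using emb_add[of "x - y" y] by (simp add: algebra_simps)

lemma emb_uminus: "\<phi> (- x) = - \<phi> x"
  using emb_diff[of 0 x] by (simp add: emb_zero)

lemma emb_sum: "\<phi> (sum f A) = (\<Sum>a\<in>A. \<phi> (f a))"
  by (induction A rule: infinite_finite_induct) (auto simp: emb_zero emb_add)

lemma emb_sign: "\<phi> ((- 1) ^ k) = (- 1) ^ k"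
  by (induction k) (auto simp: emb_one emb_uminus)

lemma emb_ext_monomial: "\<phi> (ext_monomial S U) = ext_monomial S U"
  by (simp add: ext_monomial_def emb_one emb_zero)

lemma emb_ext_linear: "\<phi> (ext_linear n \<xi> U) = ext_linear n (\<lambda>i. \<phi> (\<xi> i)) U"
  by (simp add: ext_linear_def emb_sum emb_mult emb_ext_monomial)

lemma emb_ext_boundary: "\<phi> (ext_boundary C U) = ext_boundary C U"
  by (simp add: ext_boundary_def emb_sum emb_mult emb_sign emb_ext_monomial)

text \<open>The two algebras have coefficients in \<open>'r\<close> and \<open>'e\<close>. Applying
  \<open>\<phi>\<close> to each coefficient respects products because the structure constants are 0
  and signs.\<close>

lemma ring_hom_ext_algebra:
  "ring_hom_ring (ext_algebra n) (ext_algebra n) (\<lambda>x U. \<phi> (x U))"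
  by (rule ring_hom_ringI[OF ring_ext_algebra ring_ext_algebra])
    (auto simp: ext_algebra_def wedge_sign_def emb_zero emb_add emb_sum emb_mult emb_sign
      emb_ext_monomial)

text \<open>The preimage \<open>?J\<close> of the ideal over \<open>'e\<close> is an ideal over
  \<open>'r\<close>. It contains the generators, since each is carried to the boundary of the same
  circuit, so minimality of the generated ideal applies.\<close>

lemma emb_os_ideal:
  assumes "x \<in> os_ideal n H"
  shows "(\<lambda>U. \<phi> (x U)) \<in> os_ideal n H"
proof -
  let ?S = "{ext_boundary C | C. circuit n H C}"
  let ?J = "{x \<in> carrier (ext_algebra n). (\<lambda>U. \<phi> (x U)) \<in> os_ideal n H}"
  have gens: "?S \<subseteq> os_ideal n H"
    unfolding os_ideal_def
    by (rule ring.genideal_self[OF ring_ext_algebra ext_boundaries_in_carrier])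
  have "ideal ?J (ext_algebra n)"
    by (rule ring_hom_ring.ideal_vimage[OF ring_hom_ext_algebra ideal_os_ideal])
  moreover have "?S \<subseteq> ?J"
    using gens ext_boundaries_in_carrier[of n H] by (auto simp: emb_ext_boundary)
  ultimately have "os_ideal n H \<subseteq> ?J"
    unfolding os_ideal_def by (rule ring.genideal_minimal[OF ring_ext_algebra])
  with assms show ?thesis by blast
qed

lemma emb_os_annihilator:
  assumes "\<eta> \<in> os_annihilator n H l"
  shows "(\<lambda>i. \<phi> (\<eta> i)) \<in> os_annihilator n H (\<lambda>i. \<phi> (l i))"
proof -
  interpret ring_hom_ring "ext_algebra n" "ext_algebra n" "\<lambda>x U. \<phi> (x U)"
    by (rule ring_hom_ext_algebra)
  have "(\<lambda>U. \<phi> ((ext_linear n l \<otimes>\<^bsub>ext_algebra n\<^esub> ext_linear n \<eta>) U)) \<in> os_ideal n H"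
    using assms by (intro emb_os_ideal) (simp add: mem_os_annihilator_iff)
  then show ?thesis
    by (simp add: mem_os_annihilator_iff ext_linear_in_carrier emb_ext_linear)
qed

end

section \<open>Existence of generic partners\<close>

text \<open>The functionals tested in (i) and (ii). Being a set of functions, it counts coinciding
  functionals once, so its size is only bounded above.\<close>

definition partner_functionals ::
  "nat \<Rightarrow> (nat \<Rightarrow> (complex ^ 'l) set) \<Rightarrow> (nat \<Rightarrow> 's::comm_ring_1) \<Rightarrow> ((nat \<Rightarrow> 's) \<Rightarrow> 's) set"
  where "partner_functionals n H l =
    (\<lambda>X \<eta>. \<Sum>i\<in>X. \<eta> i) ` lines0 n H \<union>
    (\<lambda>(i, j) \<eta>. l i * \<eta> j - l j * \<eta> i) ` {(i, j). 1 \<le> i \<and> i < j \<and> j \<le> n}"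

lemma partner_functionals_combination:
  "f \<in> partner_functionals n H l \<Longrightarrow> f (\<lambda>i. v i + t * w i) = f v + t * f w"
  by (auto simp: partner_functionals_def sum.distrib sum_distrib_left algebra_simps)

lemma finite_lines0: "finite (lines0 n H)"
  by (rule finite_subset[of _ "Pow {1..n}"]) (auto simp: lines0_def matroid_lines_def)

lemma finite_card_ordered_pairs:
  "finite {(i, j). 1 \<le> i \<and> i < j \<and> j \<le> (n::nat)} \<and>
   card {(i, j). 1 \<le> i \<and> i < j \<and> j \<le> n} \<le> n choose 2"
proof -
  let ?P = "{(i, j). 1 \<le> i \<and> i < j \<and> j \<le> n}"
  let ?Q = "{B. B \<subseteq> {1..n} \<and> card B = 2}"
  have inj: "inj_on (\<lambda>(i, j). {i, j}) ?P" by (auto simp: inj_on_def doubleton_eq_iff)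
  have sub: "(\<lambda>(i, j). {i, j}) ` ?P \<subseteq> ?Q" by auto
  have fin: "finite ?Q" by (rule finite_subset[of _ "Pow {1..n}"]) auto
  have "card ?Q = n choose 2" using n_subsets[of "{1..n}" 2] by simp
  with card_inj_on_le[OF inj sub fin] inj_on_finite[OF inj sub fin] show ?thesis by simp
qed

lemma finite_partner_functionals: "finite (partner_functionals n H l)"
  using finite_lines0 finite_card_ordered_pairs by (auto simp: partner_functionals_def)

lemma card_partner_functionals:
  fixes l :: "nat \<Rightarrow> 's::comm_ring_1"
  shows "card (partner_functionals n H l) \<le> (n choose 2) + card (lines0 n H)"
proof -
  let ?P = "{(i, j). 1 \<le> i \<and> i < j \<and> j \<le> n}"
  let ?L = "(\<lambda>X (\<eta> :: nat \<Rightarrow> 's). \<Sum>i\<in>X. \<eta> i) ` lines0 n H"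
  let ?D = "(\<lambda>(i, j) \<eta>. l i * \<eta> j - l j * \<eta> i) ` ?P"
  have "card ?L \<le> card (lines0 n H)" by (rule card_image_le[OF finite_lines0])
  moreover have "card ?D \<le> card ?P"
    by (rule card_image_le[OF conjunct1[OF finite_card_ordered_pairs]])
  moreover have "card ?P \<le> n choose 2" using finite_card_ordered_pairs by blast
  moreover have "card (?L \<union> ?D) \<le> card ?L + card ?D" by (rule card_Un_le)
  ultimately show ?thesis unfolding partner_functionals_def by linarith
qed

text \<open>Contrapositive of (i) and (ii): a functional that kills \<open>\<mu>\<close> kills the
  image of \<open>\<eta>\<close>, and injectivity of \<open>\<phi>\<close> brings the equation back
  to \<open>\<eta>\<close>.\<close>

lemma generic_partnerI:
  assumes "\<mu> \<in> os_annihilator n H (\<lambda>i. \<phi> (l i))"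
    and emb: "ring_embedding \<phi>"
    and nz: "\<And>f \<eta>. f \<in> partner_functionals n H (\<lambda>i. \<phi> (l i)) \<Longrightarrow> \<eta> \<in> os_annihilator n H l \<Longrightarrow>
      f (\<lambda>i. \<phi> (\<eta> i)) \<noteq> 0 \<Longrightarrow> f \<mu> \<noteq> 0"
  shows "generic_partner n H \<phi> l \<mu>"
  unfolding generic_partner_def
proof (intro conjI ballI allI impI)
  fix X \<eta> assume X: "X \<in> lines0 n H" "sum \<mu> X = 0" and \<eta>: "\<eta> \<in> os_annihilator n H l"
  have "(\<lambda>\<eta>. sum \<eta> X) \<in> partner_functionals n H (\<lambda>i. \<phi> (l i))"
    using X(1) by (auto simp: partner_functionals_def)
  from nz[OF this \<eta>] X(2) show "sum \<eta> X = 0"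
    by (auto simp: emb_eq_0_iff[OF emb] simp flip: emb_sum[OF emb])
next
  fix i j \<eta>
  assume ij: "1 \<le> i \<and> i < j \<and> j \<le> n \<and> \<phi> (l i) * \<mu> j - \<phi> (l j) * \<mu> i = 0"
    and \<eta>: "\<eta> \<in> os_annihilator n H l"
  have "(\<lambda>\<eta>. \<phi> (l i) * \<eta> j - \<phi> (l j) * \<eta> i) \<in> partner_functionals n H (\<lambda>i. \<phi> (l i))"
    using ij by (auto simp: partner_functionals_def)
  from nz[OF this \<eta>] ij show "l i * \<eta> j - l j * \<eta> i = 0"
    by (auto simp: emb_eq_0_iff[OF emb] simp flip: emb_mult[OF emb] emb_diff[OF emb])
qed fact

lemma partner_functionals_avoid:
  fixes l :: "nat \<Rightarrow> 's::idom"
  assumes "infinite (UNIV :: 's set) \<or>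
    card (UNIV :: 's set) > (n choose 2) + card (lines0 n H)"
  obtains \<mu> where "\<mu> \<in> os_annihilator n H l"
    "\<And>f \<eta>. f \<in> partner_functionals n H l \<Longrightarrow> \<eta> \<in> os_annihilator n H l \<Longrightarrow> f \<eta> \<noteq> 0 \<Longrightarrow> f \<mu> \<noteq> 0"
proof -
  let ?Z = "os_annihilator n H l"
  \<comment> \<open>Functionals vanishing on all of \<open>?Z\<close> impose no condition and are
    discarded; each of the others has the nonzero value that the avoidance lemma asks for.\<close>
  let ?F = "{f \<in> partner_functionals n H l. \<exists>\<eta>\<in>?Z. f \<eta> \<noteq> 0}"
  have "card ?F \<le> (n choose 2) + card (lines0 n H)"
    using card_mono[OF finite_partner_functionals[of n H l], of ?F] card_partner_functionals[of n H l]
    by fastforce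
  then have "\<exists>\<mu>\<in>?Z. \<forall>f\<in>?F. f \<mu> \<noteq> 0"
    using assms finite_partner_functionals[of n H l] zero_in_os_annihilator[of n H l]
    by (intro common_nonzero_of_functionals)
      (auto simp: partner_functionals_combination intro: os_annihilator_combination)
  then show ?thesis using that by blast
qed

text \<open>On vectors coming from \<open>'r\<close>, a functional with coefficients over
  \<open>'e\<close> is \<open>\<phi>\<close> after its counterpart over \<open>'r\<close>. This
  moves genericity of a vector found over \<open>'r\<close> to its image.\<close>

lemma emb_partner_functionals:
  assumes emb: "ring_embedding \<phi>" and "f \<in> partner_functionals n H (\<lambda>i. \<phi> (l i))"
  obtains g where "g \<in> partner_functionals n H l" "\<And>\<eta>. f (\<lambda>i. \<phi> (\<eta> i)) = \<phi> (g \<eta>)"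
  using assms(2) unfolding partner_functionals_def
proof (elim UnE imageE)
  fix X assume "f = (\<lambda>\<eta>. sum \<eta> X)" "X \<in> lines0 n H"
  then show thesis
    by (intro that[of "\<lambda>\<eta>. sum \<eta> X"]) (auto simp: partner_functionals_def emb_sum[OF emb])
next
  fix p assume "f = (case p of (i, j) \<Rightarrow> \<lambda>\<eta>. \<phi> (l i) * \<eta> j - \<phi> (l j) * \<eta> i)"
    "p \<in> {(i, j). 1 \<le> i \<and> i < j \<and> j \<le> n}"
  then show thesis
    by (intro that[of "case p of (i, j) \<Rightarrow> \<lambda>\<eta>. l i * \<eta> j - l j * \<eta> i"])
      (auto simp: partner_functionals_def emb_mult[OF emb] emb_diff[OF emb])
qed

theorem theorem3p15:
  fixes H :: "nat \<Rightarrow> (complex ^ 'l) set"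
    and n :: nat
    and \<phi> :: "'r::idom \<Rightarrow> 'e::field"
  assumes "arrangement n H"
    and "ring_embedding \<phi>"
  shows "(infinite (UNIV :: 'e set) \<or>
           card (UNIV :: 'e set) > (n choose 2) + card (lines0 n H) \<longrightarrow>
             (\<forall>l :: nat \<Rightarrow> 'r. \<exists>\<mu> :: nat \<Rightarrow> 'e. generic_partner n H \<phi> l \<mu>)) \<and>
         (infinite (UNIV :: 'r set) \<longrightarrow>
             (\<forall>l :: nat \<Rightarrow> 'r. \<exists>\<mu> :: nat \<Rightarrow> 'r. generic_partner n H \<phi> l (\<lambda>i. \<phi> (\<mu> i))))"
proof (intro conjI impI allI)
  fix l :: "nat \<Rightarrow> 'r"
  assume "infinite (UNIV :: 'e set) \<or>
    card (UNIV :: 'e set) > (n choose 2) + card (lines0 n H)"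
  then obtain \<mu> where \<mu>: "\<mu> \<in> os_annihilator n H (\<lambda>i. \<phi> (l i))"
    "\<And>f \<eta>. f \<in> partner_functionals n H (\<lambda>i. \<phi> (l i)) \<Longrightarrow>
      \<eta> \<in> os_annihilator n H (\<lambda>i. \<phi> (l i)) \<Longrightarrow> f \<eta> \<noteq> 0 \<Longrightarrow> f \<mu> \<noteq> 0"
    using partner_functionals_avoid[where l = "\<lambda>i. \<phi> (l i)" and H = H and n = n] by metis
  \<comment> \<open>An \<open>\<eta>\<close> over \<open>'r\<close> on which a functional is nonzero
    has its image in the annihilator over \<open>'e\<close>, where \<open>\<mu>\<close> was chosen
    to avoid that functional.\<close>
  show "\<exists>\<mu>. generic_partner n H \<phi> l \<mu>"
    by (rule exI, rule generic_partnerI[OF \<mu>(1) assms(2)],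
        rule \<mu>(2)[OF _ emb_os_annihilator[OF assms(2)]])
next
  fix l :: "nat \<Rightarrow> 'r"
  assume "infinite (UNIV :: 'r set)"
  then obtain \<mu> where \<mu>: "\<mu> \<in> os_annihilator n H l"
    "\<And>f \<eta>. f \<in> partner_functionals n H l \<Longrightarrow> \<eta> \<in> os_annihilator n H l \<Longrightarrow> f \<eta> \<noteq> 0 \<Longrightarrow> f \<mu> \<noteq> 0"
    using partner_functionals_avoid[where l = l and H = H and n = n] by metis
  have "generic_partner n H \<phi> l (\<lambda>i. \<phi> (\<mu> i))"
  proof (rule generic_partnerI[OF emb_os_annihilator[OF assms(2) \<mu>(1)] assms(2)])
    fix f \<eta>
    assume f: "f \<in> partner_functionals n H (\<lambda>i. \<phi> (l i))"
      and \<eta>: "\<eta> \<in> os_annihilator n H l" "f (\<lambda>i. \<phi> (\<eta> i)) \<noteq> 0"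
    obtain g where "g \<in> partner_functionals n H l" "\<And>\<eta>. f (\<lambda>i. \<phi> (\<eta> i)) = \<phi> (g \<eta>)"
      using emb_partner_functionals[OF assms(2) f] by blast
    \<comment> \<open>Here \<open>g \<eta> \<noteq> 0\<close>, so \<open>g \<mu> \<noteq> 0\<close>
      by the choice of \<open>\<mu>\<close>, and \<open>\<phi>\<close> preserves this.\<close>
    with \<mu>(2) \<eta> show "f (\<lambda>i. \<phi> (\<mu> i)) \<noteq> 0" by (simp add: emb_eq_0_iff[OF assms(2)])
  qed
  then show "\<exists>\<mu>. generic_partner n H \<phi> l (\<lambda>i. \<phi> (\<mu> i))" by blast
qed

end
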